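(* Let $A$ be a perm algebra, $E$ a vector space containing $A$ as a subspace, and $\diamond$ a perm algebra structure on $E$ such that $A$ is a subalgebra of $(E,\diamond)$. Then there exist a subspace $V$ of $E$ (a complement of $A$ in $E$), a perm extending structure $\Omega(A,V)=(\blacktriangleright,\blacktriangleleft,\triangleright,\triangleleft,\chi,\cdot)$ of $A$ by $V$, and an isomorphism of perm algebras $(E,\diamond)\cong A\natural V$ which stabilizes $A$ and co-stabilizes $V$.
   Context: All vector spaces are over a field $\mathbb{K}$ of characteristic zero. A perm algebra is a vector space $A$ with a bilinear product satisfying $(a_1a_2)a_3=a_1(a_2a_3)=a_1(a_3a_2)$ for all $a_1,a_2,a_3\in A$ (no unit is required). An extending datum of a perm algebra $A$ by a vector space $V$ is a system $\Omega(A,V)=(\blacktriangleright,\blacktriangleleft,\triangleright,\triangleleft,\chi,\cdot)$ of bilinear maps $\blacktriangleright:A\times V\to V$, $\blacktriangleleft:V\times A\to V$, $\triangleright:V\times A\to A$, $\triangleleft:A\times V\to A$, $\chi:V\times V\to A$, $\cdot:V\times V\to V$. Denote by $A\natural V$ the vector space $A\oplus V$ with the bilinear product $$(a_1,v_1)\ast(a_2,v_2)=\big(a_1a_2+v_1\triangleright a_2+a_1\triangleleft v_2+\chi(v_1,v_2),\ v_1\cdot v_2+a_1\blacktriangleright v_2+v_1\blacktriangleleft a_2\big).$$ If $(A\oplus V,\ast)$ is a perm algebra, $A\natural V$ is called the unified product and $\Omega(A,V)$ is called a perm extending structure of $A$ by $V$. For a complement $V$ of $A$ in $E$, let $\iota:A\to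 E$ be the inclusion and $\pi:E\to V$ the projection along $A$; for $A\natural V$ let $\iota_A(a)=(a,0)$ and $\pi_V(a,v)=v$. A linear map $\varphi:A\natural V\to E$ (or its inverse) stabilizes $A$ if $\varphi\circ\iota_A=\iota$, and co-stabilizes $V$ if $\pi\circ\varphi=\pi_V$. *)

theory Defs
  imports "HOL-Analysis.Product_Vector"
begin

text \<open>
  Vector spaces are linear subspaces (carrier sets) of an ambient type with a scalar multiplication
  satisfying \<^locale>\<open>vector_space\<close>; maps between them are total functions whose values
  matter only on the carriers. Carriers are needed because complements of a given subspace have to be
  quantified over.
\<close>

definition vector_space_on :: "('k::field \<Rightarrow> 'a::ab_group_add \<Rightarrow> 'a) \<Rightarrow> 'a set \<Rightarrow> bool" where
  "vector_space_on s S \<longleftrightarrow> vector_space s \<and> module.subspace s S"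

definition linear_on ::
  "('k::field \<Rightarrow> 'a::ab_group_add \<Rightarrow> 'a) \<Rightarrow> 'a set \<Rightarrow> ('k \<Rightarrow> 'b::ab_group_add \<Rightarrow> 'b) \<Rightarrow> 'b set \<Rightarrow>
   ('a \<Rightarrow> 'b) \<Rightarrow> bool" where
  "linear_on s S t T f \<longleftrightarrow>
     (\<forall>x\<in>S. f x \<in> T) \<and>
     (\<forall>x\<in>S. \<forall>y\<in>S. f (x + y) = f x + f y) \<and>
     (\<forall>c. \<forall>x\<in>S. f (s c x) = t c (f x))"

definition bilinear_on ::
  "('k::field \<Rightarrow> 'a::ab_group_add \<Rightarrow> 'a) \<Rightarrow> 'a set \<Rightarrow> ('k \<Rightarrow> 'b::ab_group_add \<Rightarrow> 'b) \<Rightarrow> 'b set \<Rightarrow>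
   ('k \<Rightarrow> 'c::ab_group_add \<Rightarrow> 'c) \<Rightarrow> 'c set \<Rightarrow> ('a \<Rightarrow> 'b \<Rightarrow> 'c) \<Rightarrow> bool" where
  "bilinear_on s S t T u U f \<longleftrightarrow>
     (\<forall>x\<in>S. linear_on t T u U (\<lambda>y. f x y)) \<and>
     (\<forall>y\<in>T. linear_on s S u U (\<lambda>x. f x y))"

definition perm_algebra ::
  "('k::field \<Rightarrow> 'a::ab_group_add \<Rightarrow> 'a) \<Rightarrow> 'a set \<Rightarrow> ('a \<Rightarrow> 'a \<Rightarrow> 'a) \<Rightarrow> bool" where
  "perm_algebra s A m \<longleftrightarrow>
     vector_space_on s A \<and> bilinear_on s A s A s A m \<and>
     (\<forall>a\<in>A. \<forall>b\<in>A. \<forall>c\<in>A. m (m a b) c = m a (m b c) \<and> m a (m b c) = m a (m c b))"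

definition subalgebra :: "'a set \<Rightarrow> ('a \<Rightarrow> 'a \<Rightarrow> 'a) \<Rightarrow> 'a set \<Rightarrow> ('a \<Rightarrow> 'a \<Rightarrow> 'a) \<Rightarrow> bool" where
  "subalgebra A mA E m \<longleftrightarrow> A \<subseteq> E \<and> (\<forall>a\<in>A. \<forall>b\<in>A. mA a b \<in> A \<and> m a b = mA a b)"

definition perm_algebra_iso ::
  "('k::field \<Rightarrow> 'a::ab_group_add \<Rightarrow> 'a) \<Rightarrow> 'a set \<Rightarrow> ('a \<Rightarrow> 'a \<Rightarrow> 'a) \<Rightarrow>
   ('k \<Rightarrow> 'b::ab_group_add \<Rightarrow> 'b) \<Rightarrow> 'b set \<Rightarrow> ('b \<Rightarrow> 'b \<Rightarrow> 'b) \<Rightarrow> ('a \<Rightarrow> 'b) \<Rightarrow> bool" where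
  "perm_algebra_iso s A mA t B mB f \<longleftrightarrow>
     perm_algebra s A mA \<and> perm_algebra t B mB \<and>
     linear_on s A t B f \<and> bij_betw f A B \<and>
     (\<forall>x\<in>A. \<forall>y\<in>A. f (mA x y) = mB (f x) (f y))"

record ('a, 'v) ext_datum =
  lact_V :: "'a \<Rightarrow> 'v \<Rightarrow> 'v"   (* black right triangle, A x V -> V *)
  ract_V :: "'v \<Rightarrow> 'a \<Rightarrow> 'v"   (* black left triangle,  V x A -> V *)
  lact_A :: "'v \<Rightarrow> 'a \<Rightarrow> 'a"   (* white right triangle, V x A -> A *)
  ract_A :: "'a \<Rightarrow> 'v \<Rightarrow> 'a"   (* white left triangle,  A x V -> A *)
  chi :: "'v \<Rightarrow> 'v \<Rightarrow> 'a"
  dot :: "'v \<Rightarrow> 'v \<Rightarrow> 'v"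

definition extending_datum ::
  "('k::field \<Rightarrow> 'a::ab_group_add \<Rightarrow> 'a) \<Rightarrow> 'a set \<Rightarrow> ('a \<Rightarrow> 'a \<Rightarrow> 'a) \<Rightarrow>
   ('k \<Rightarrow> 'v::ab_group_add \<Rightarrow> 'v) \<Rightarrow> 'v set \<Rightarrow> ('a, 'v) ext_datum \<Rightarrow> bool" where
  "extending_datum s A mA t V \<Omega> \<longleftrightarrow>
     perm_algebra s A mA \<and> vector_space_on t V \<and>
     bilinear_on s A t V t V (lact_V \<Omega>) \<and>
     bilinear_on t V s A t V (ract_V \<Omega>) \<and>
     bilinear_on t V s A s A (lact_A \<Omega>) \<and>
     bilinear_on s A t V s A (ract_A \<Omega>) \<and>
     bilinear_on t V t V s A (chi \<Omega>) \<and>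
     bilinear_on t V t V t V (dot \<Omega>)"

definition unified_mult ::
  "('a::ab_group_add \<Rightarrow> 'a \<Rightarrow> 'a) \<Rightarrow> ('a, 'v::ab_group_add) ext_datum \<Rightarrow>
   'a \<times> 'v \<Rightarrow> 'a \<times> 'v \<Rightarrow> 'a \<times> 'v" where
  "unified_mult mA \<Omega> = (\<lambda>(a1, v1) (a2, v2).
     (mA a1 a2 + lact_A \<Omega> v1 a2 + ract_A \<Omega> a1 v2 + chi \<Omega> v1 v2,
      dot \<Omega> v1 v2 + lact_V \<Omega> a1 v2 + ract_V \<Omega> v1 a2))"

text \<open>The vector space \<open>A \<oplus> V\<close> is \<open>A \<times> V\<close> with the componentwise operations.\<close>

definition perm_extending_structure ::
  "('k::field \<Rightarrow> 'a::ab_group_add \<Rightarrow> 'a) \<Rightarrow> 'a set \<Rightarrow> ('a \<Rightarrow> 'a \<Rightarrow> 'a) \<Rightarrow>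
   ('k \<Rightarrow> 'v::ab_group_add \<Rightarrow> 'v) \<Rightarrow> 'v set \<Rightarrow> ('a, 'v) ext_datum \<Rightarrow> bool" where
  "perm_extending_structure s A mA t V \<Omega> \<longleftrightarrow>
     extending_datum s A mA t V \<Omega> \<and>
     perm_algebra (module_prod.scale s t) (A \<times> V) (unified_mult mA \<Omega>)"

definition complement_in ::
  "('k::field \<Rightarrow> 'e::ab_group_add \<Rightarrow> 'e) \<Rightarrow> 'e set \<Rightarrow> 'e set \<Rightarrow> 'e set \<Rightarrow> bool" where
  "complement_in s E A V \<longleftrightarrow>
     module.subspace s V \<and> A \<inter> V = {0} \<and> {a + v | a v. a \<in> A \<and> v \<in> V} = E"

text \<open>For a complement \<open>V\<close> of \<open>A\<close>, the projection onto \<open>V\<close> along \<open>A\<close>.\<close>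

definition proj_along :: "'e::ab_group_add set \<Rightarrow> 'e set \<Rightarrow> 'e \<Rightarrow> 'e" where
  "proj_along A V e = (THE v. v \<in> V \<and> e - v \<in> A)"

definition stabilizes :: "'e::ab_group_add set \<Rightarrow> ('e \<times> 'e \<Rightarrow> 'e) \<Rightarrow> bool" where
  "stabilizes A \<phi> \<longleftrightarrow> (\<forall>a\<in>A. \<phi> (a, 0) = a)"

definition co_stabilizes :: "'e::ab_group_add set \<Rightarrow> 'e set \<Rightarrow> ('e \<times> 'e \<Rightarrow> 'e) \<Rightarrow> bool" where
  "co_stabilizes A V \<phi> \<longleftrightarrow> (\<forall>a\<in>A. \<forall>v\<in>V. proj_along A V (\<phi> (a, v)) = v)"

end

theory Submission
  imports Defs
begin

text \<open>
  Over a field every subspace \<open>A\<close> of \<open>E\<close> has a complement \<open>V\<close> (\<open>complement_in_exists\<close>), and the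
  addition map \<open>\<phi> (a, v) = a + v\<close> is a linear isomorphism of \<open>A \<oplus> V\<close> onto \<open>E\<close>.  Writing \<open>p\<close> for
  the projection onto \<open>V\<close> along \<open>A\<close> and \<open>q = id - p\<close> for the projection onto \<open>A\<close>, the extending
  datum consists of the components of the multiplication of \<open>E\<close>:
  for example \<open>a\<close> acts on \<open>v\<close> by \<open>p (a v)\<close>, and \<open>\<chi> v w = q (v w)\<close>.
  Expanding \<open>(a1 + v1)(a2 + v2)\<close> into four products and splitting each of them except \<open>a1 a2\<close>
  as \<open>e = q e + p e\<close> shows that \<open>\<phi>\<close> is multiplicative for the unified multiplication
  (\<open>component_datum_mult\<close>); the product \<open>a1 a2\<close> has no \<open>V\<close>-component because \<open>A\<close> is a
  subalgebra.  The perm identities of the unified product then need no computation: they are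
  pulled back from \<open>E\<close> along the linear bijection \<open>\<phi>\<close> (\<open>perm_algebra_pullback\<close>).
\<close>

section \<open>Complements and projections\<close>

text \<open>The complement is the part of \<open>E\<close> in the kernel of a linear retraction of the ambient space
  onto \<open>A\<close>, which exists by extending the identity of \<open>A\<close>.\<close>

lemma complement_in_exists:
  assumes "vector_space_on s E" and "vector_space_on s A" and AE: "A \<subseteq> E"
  shows "\<exists>V. complement_in s E A V"
proof -
  have vs: "vector_space s" and sE: "module.subspace s E" and sA: "module.subspace s A"
    using assms by (auto simp: vector_space_on_def)
  interpret vector_space s by (fact vs)
  interpret P: vector_space_pair s s by unfold_locales
  obtain g where gA: "range g \<subseteq> A" and g: "Vector_Spaces.linear s s g"
    and gid: "\<forall>a\<in>A. g a = a"
    using P.linear_exists_left_inverse_on[OF linear_id sA] by auto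
  interpret g: Vector_Spaces.linear s s g by (fact g)
  define V where "V = E \<inter> {e. g e = 0}"
  have "subspace V"
    unfolding V_def using sE g.subspace_kernel by (rule subspace_inter)
  moreover have "A \<inter> V = {0}"
    using gid subspace_0[OF sA] subspace_0[OF sE] by (auto simp: V_def)
  moreover have "{a + v | a v. a \<in> A \<and> v \<in> V} = E"
  proof (intro set_eqI iffI)
    fix e assume "e \<in> {a + v | a v. a \<in> A \<and> v \<in> V}"
    then show "e \<in> E" using subspace_add[OF sE] AE by (auto simp: V_def)
  next
    fix e assume e: "e \<in> E"
    have "g e \<in> A" using gA by auto
    moreover have "e - g e \<in> V"
      using e AE \<open>g e \<in> A\<close> gid subspace_diff[OF sE] by (auto simp: V_def g.diff)
    moreover have "e = g e + (e - g e)" by simp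
    ultimately show "e \<in> {a + v | a v. a \<in> A \<and> v \<in> V}" by blast
  qed
  ultimately show ?thesis unfolding complement_in_def by blast
qed

lemma proj_along_add:
  assumes "vector_space_on s A" and c: "complement_in s E A V" and a: "a \<in> A" and v: "v \<in> V"
  shows "proj_along A V (a + v) = v"
proof -
  have vs: "vector_space s" and sA: "module.subspace s A" and sV: "module.subspace s V"
    and AV: "A \<inter> V = {0}"
    using assms by (auto simp: vector_space_on_def complement_in_def)
  interpret vector_space s by (fact vs)
  have "w = v" if w: "w \<in> V" and d: "a + v - w \<in> A" for w
  proof -
    have "(a + v - w) - a \<in> A" using subspace_diff[OF sA d a] .
    then have "v - w \<in> A \<inter> V" using subspace_diff[OF sV v w] by (simp add: algebra_simps)
    then show ?thesis using AV by simp
  qed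
  then show ?thesis unfolding proj_along_def using a v by (intro the_equality) auto
qed

lemma complement_inE:
  assumes "complement_in s E A V" and "e \<in> E"
  obtains a v where "a \<in> A" "v \<in> V" "e = a + v"
  using assms by (auto simp: complement_in_def)

lemma complement_in_subset:
  assumes c: "complement_in s E A V"
  shows "V \<subseteq> E"
proof
  fix v assume v: "v \<in> V"
  have sum: "E = {a + v | a v. a \<in> A \<and> v \<in> V}" and "0 \<in> A"
    using c by (auto simp: complement_in_def)
  have "0 + v \<in> E" unfolding sum using \<open>0 \<in> A\<close> v by blast
  then show "v \<in> E" by simp
qed

lemma linear_on_proj_along:
  assumes A: "vector_space_on s A" and c: "complement_in s E A V"
  shows "linear_on s E s V (proj_along A V)"
    and "linear_on s E s A (\<lambda>e. e - proj_along A V e)"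
proof -
  have vs: "vector_space s" and sA: "module.subspace s A" and sV: "module.subspace s V"
    using assms by (auto simp: vector_space_on_def complement_in_def)
  interpret vector_space s by (fact vs)
  note p = proj_along_add[OF A c]
  have mem: "proj_along A V e \<in> V \<and> e - proj_along A V e \<in> A" if "e \<in> E" for e
    using that by (elim complement_inE[OF c]) (simp add: p)
  have add: "proj_along A V (x + y) = proj_along A V x + proj_along A V y"
    if x: "x \<in> E" and y: "y \<in> E" for x y
  proof -
    obtain a v b w where ab: "a \<in> A" "v \<in> V" "x = a + v" "b \<in> A" "w \<in> V" "y = b + w"
      using complement_inE[OF c x] complement_inE[OF c y] by metis
    then have "x + y = (a + b) + (v + w)" by (simp add: algebra_simps)
    then have "proj_along A V (x + y) = v + w"
      using p[OF subspace_add[OF sA ab(1,4)] subspace_add[OF sV ab(2,5)]] by (simp only:)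
    then show ?thesis using ab by (simp add: p)
  qed
  have scl: "proj_along A V (s k x) = s k (proj_along A V x)" if x: "x \<in> E" for k x
  proof -
    obtain a v where av: "a \<in> A" "v \<in> V" "x = a + v" using complement_inE[OF c x] .
    then show ?thesis
      using p[OF subspace_scale[OF sA av(1), of k] subspace_scale[OF sV av(2), of k]]
      by (simp add: p scale_right_distrib)
  qed
  show "linear_on s E s V (proj_along A V)"
    using mem add scl by (simp add: linear_on_def)
  show "linear_on s E s A (\<lambda>e. e - proj_along A V e)"
    using mem add scl by (simp add: linear_on_def scale_right_diff_distrib)
qed

lemma linear_on_add_complement:
  assumes "vector_space s" and c: "complement_in s E A V"
  shows "linear_on (module_prod.scale s s) (A \<times> V) s E (\<lambda>(a, v). a + v)"
proof -
  interpret vector_space s by (fact assms(1))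
  interpret P: vector_space_prod s s by unfold_locales
  have "a + v \<in> E" if "a \<in> A" "v \<in> V" for a v
    using c that by (auto simp: complement_in_def)
  then show ?thesis
    by (auto simp: linear_on_def P.scale_prod scale_right_distrib add_ac)
qed

lemma bij_betw_add_complement:
  assumes A: "vector_space_on s A" and c: "complement_in s E A V"
  shows "bij_betw (\<lambda>(a, v). a + v) (A \<times> V) E"
proof -
  have "inj_on (\<lambda>(a, v). a + v) (A \<times> V)"
  proof (rule inj_onI, clarify)
    fix a v b w assume *: "a \<in> A" "v \<in> V" "b \<in> A" "w \<in> V" "a + v = b + w"
    then have "v = w" using proj_along_add[OF A c] by metis
    with * show "a = b \<and> v = w" by simp
  qed
  moreover have "(\<lambda>(a, v). a + v) ` (A \<times> V) = E"
    using c by (force simp: complement_in_def)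
  ultimately show ?thesis by (simp add: bij_betw_def)
qed

section \<open>Bilinear maps and transport of perm algebra structures\<close>

lemma bilinear_on_comp:
  assumes f: "bilinear_on s S t T u U f" and g: "linear_on u U w W g"
    and "S' \<subseteq> S" and "T' \<subseteq> T"
  shows "bilinear_on s S' t T' w W (\<lambda>x y. g (f x y))"
proof -
  have "linear_on t T' w W (\<lambda>y. g (f x y))" if "x \<in> S'" for x
  proof -
    have "linear_on t T u U (f x)" using f that assms(3) by (auto simp: bilinear_on_def)
    then show ?thesis using g assms(4) by (auto simp: linear_on_def subset_iff)
  qed
  moreover have "linear_on s S' w W (\<lambda>x. g (f x y))" if "y \<in> T'" for y
  proof -
    have "linear_on s S u U (\<lambda>x. f x y)" using f that assms(4) by (auto simp: bilinear_on_def)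
    then show ?thesis using g assms(3) by (auto simp: linear_on_def subset_iff)
  qed
  ultimately show ?thesis by (simp add: bilinear_on_def)
qed

text \<open>Bilinearity and the perm identities are equations in \<open>B\<close>, so an injective multiplicative
  linear map reduces each of them to the same equation in \<open>E\<close>; surjectivity plays no role.\<close>

lemma perm_algebra_pullback:
  assumes E: "perm_algebra s E mE" and B: "vector_space_on t B"
    and f: "linear_on t B s E f" and inj: "inj_on f B"
    and clo: "\<And>x y. x \<in> B \<Longrightarrow> y \<in> B \<Longrightarrow> mB x y \<in> B"
    and mult: "\<And>x y. x \<in> B \<Longrightarrow> y \<in> B \<Longrightarrow> f (mB x y) = mE (f x) (f y)"
  shows "perm_algebra t B mB"
proof -
  have vs: "vector_space t" and sB: "module.subspace t B"
    using B by (auto simp: vector_space_on_def)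
  interpret vector_space t by (fact vs)
  have fE: "f x \<in> E" and fa: "y \<in> B \<Longrightarrow> f (x + y) = f x + f y" and fs: "f (t k x) = s k (f x)"
    if "x \<in> B" for x y k
    using f that by (auto simp: linear_on_def)
  have bl: "mE x (y + z) = mE x y + mE x z" "mE (x + y) z = mE x z + mE y z"
    if "x \<in> E" "y \<in> E" "z \<in> E" for x y z
    using E that by (auto simp: perm_algebra_def bilinear_on_def linear_on_def)
  have sc: "mE x (s k y) = s k (mE x y)" "mE (s k x) y = s k (mE x y)"
    if "x \<in> E" "y \<in> E" for x y k
    using E that by (auto simp: perm_algebra_def bilinear_on_def linear_on_def)
  have pm: "mE (mE x y) z = mE x (mE y z)" "mE x (mE y z) = mE x (mE z y)"
    if "x \<in> E" "y \<in> E" "z \<in> E" for x y z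
    using E that by (auto simp: perm_algebra_def)
  note mem = clo fE subspace_add[OF sB] subspace_scale[OF sB]
  note eqI = inj_onD[OF inj]
  have "mB x (y + z) = mB x y + mB x z" "mB (x + y) z = mB x z + mB y z"
      "mB x (t k y) = t k (mB x y)" "mB (t k x) y = t k (mB x y)"
      "mB (mB x y) z = mB x (mB y z)" "mB x (mB y z) = mB x (mB z y)"
    if "x \<in> B" "y \<in> B" "z \<in> B" for x y z k
  proof -
    note xyz = that
    show "mB x (y + z) = mB x y + mB x z"
      by (rule eqI) (simp_all add: mem mult fa bl xyz)
    show "mB (x + y) z = mB x z + mB y z"
      by (rule eqI) (simp_all add: mem mult fa bl xyz)
    show "mB x (t k y) = t k (mB x y)"
      by (rule eqI) (simp_all add: mem mult fs sc xyz)
    show "mB (t k x) y = t k (mB x y)"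
      by (rule eqI) (simp_all add: mem mult fs sc xyz)
    show "mB (mB x y) z = mB x (mB y z)"
      by (rule eqI) (simp_all add: mem mult pm(1) xyz)
    show "mB x (mB y z) = mB x (mB z y)"
      using pm(2)[of "f x" "f y" "f z"] by (intro eqI) (simp_all add: mem mult xyz)
  qed
  then show ?thesis
    using B clo by (simp add: perm_algebra_def bilinear_on_def linear_on_def)
qed

section \<open>The extending datum of a complement\<close>

text \<open>The extending datum of \<open>A\<close> by \<open>V\<close> read off from a multiplication \<open>m\<close> on \<open>E = A \<oplus> V\<close>:
  each map is a component of \<open>m\<close>, obtained with the projection \<open>proj_along A V\<close> onto \<open>V\<close> or with
  the complementary projection onto \<open>A\<close>.\<close>

definition component_datum ::
  "'e::ab_group_add set \<Rightarrow> 'e set \<Rightarrow> ('e \<Rightarrow> 'e \<Rightarrow> 'e) \<Rightarrow> ('e, 'e) ext_datum" where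
  "component_datum A V m =
     \<lparr>lact_V = (\<lambda>a v. proj_along A V (m a v)),
      ract_V = (\<lambda>v a. proj_along A V (m v a)),
      lact_A = (\<lambda>v a. m v a - proj_along A V (m v a)),
      ract_A = (\<lambda>a v. m a v - proj_along A V (m a v)),
      chi = (\<lambda>v w. m v w - proj_along A V (m v w)),
      dot = (\<lambda>v w. proj_along A V (m v w))\<rparr>"

lemma extending_datum_component_datum:
  assumes A: "perm_algebra s A mA" and E: "perm_algebra s E mE" and AE: "A \<subseteq> E"
    and c: "complement_in s E A V"
  shows "extending_datum s A mA s V (component_datum A V mE)"
proof -
  have vA: "vector_space_on s A" and m: "bilinear_on s E s E s E mE"
    using A E by (auto simp: perm_algebra_def)
  have VE: "V \<subseteq> E" using complement_in_subset[OF c] .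
  have vV: "vector_space_on s V"
    using vA c by (auto simp: vector_space_on_def complement_in_def)
  note p = linear_on_proj_along[OF vA c]
  show ?thesis
    unfolding extending_datum_def component_datum_def ext_datum.simps
    by (intro conjI A vV bilinear_on_comp[OF m p(1)] bilinear_on_comp[OF m p(2)] AE VE)
qed

lemma component_datum_mult:
  assumes E: "perm_algebra s E mE" and sub: "subalgebra A mA E mE" and VE: "V \<subseteq> E"
    and "a \<in> A" "v \<in> V" "b \<in> A" "w \<in> V"
  shows "(\<lambda>(a, v). a + v) (unified_mult mA (component_datum A V mE) (a, v) (b, w))
         = mE (a + v) (b + w)"
proof -
  have mem: "a \<in> E" "v \<in> E" "b \<in> E" "w \<in> E" "b + w \<in> E"
  proof -
    show "a \<in> E" "v \<in> E" "b \<in> E" "w \<in> E"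
      using assms by (auto simp: subalgebra_def)
    moreover have "module s" "module.subspace s E"
      using E by (auto simp: perm_algebra_def vector_space_on_def module_iff_vector_space)
    ultimately show "b + w \<in> E" by (metis module.subspace_add)
  qed
  have "mE x (y + z) = mE x y + mE x z" "mE (x + y) z = mE x z + mE y z"
    if "x \<in> E" "y \<in> E" "z \<in> E" for x y z
    using E that by (auto simp: perm_algebra_def bilinear_on_def linear_on_def)
  then have "mE (a + v) (b + w) = mE a b + mE a w + (mE v b + mE v w)"
    using mem by simp
  moreover have "mE a b = mA a b" using sub assms by (auto simp: subalgebra_def)
  ultimately show ?thesis
    by (simp add: unified_mult_def component_datum_def algebra_simps)
qed

lemma unified_mult_closed:
  assumes d: "extending_datum s A mA t V \<Omega>" and "x \<in> A \<times> V" "y \<in> A \<times> V"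
  shows "unified_mult mA \<Omega> x y \<in> A \<times> V"
proof -
  have mods: "module s" "module t" and sub: "module.subspace s A" "module.subspace t V"
    using d by (auto simp: extending_datum_def perm_algebra_def vector_space_on_def
        module_iff_vector_space)
  note add = module.subspace_add[OF mods(1) sub(1)] module.subspace_add[OF mods(2) sub(2)]
  show ?thesis
    using assms
    by (auto simp: extending_datum_def perm_algebra_def bilinear_on_def linear_on_def
        unified_mult_def intro!: add)
qed

section \<open>Recovering the ambient perm algebra as a unified product\<close>

theorem theorem2p12:
  fixes scale :: "'k::field_char_0 \<Rightarrow> 'e::ab_group_add \<Rightarrow> 'e"
    and E A :: "'e set"
    and mA mE :: "'e \<Rightarrow> 'e \<Rightarrow> 'e"
  assumes "perm_algebra scale A mA"
    and "perm_algebra scale E mE"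
    and "subalgebra A mA E mE"
  shows "\<exists>V \<Omega> \<phi>.
    complement_in scale E A V \<and>
    perm_extending_structure scale A mA scale V \<Omega> \<and>
    perm_algebra_iso (module_prod.scale scale scale) (A \<times> V) (unified_mult mA \<Omega>) scale E mE \<phi> \<and>
    stabilizes A \<phi> \<and> co_stabilizes A V \<phi>"
proof -
  have vA: "vector_space_on scale A" and vE: "vector_space_on scale E" and AE: "A \<subseteq> E"
    and vs: "vector_space scale"
    using assms by (auto simp: perm_algebra_def subalgebra_def vector_space_on_def)
  obtain V where c: "complement_in scale E A V"
    using complement_in_exists[OF vE vA AE] by blast
  define \<Omega> where "\<Omega> = component_datum A V mE"
  define \<phi> :: "'e \<times> 'e \<Rightarrow> 'e" where "\<phi> = (\<lambda>(a, v). a + v)"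
  interpret vector_space scale by (fact vs)
  interpret P: vector_space_prod scale scale by unfold_locales
  have "P.p.subspace (A \<times> V)"
    using vA c by (intro P.subspace_Times) (auto simp: vector_space_on_def complement_in_def)
  then have vAV: "vector_space_on P.scale (A \<times> V)"
    using P.p.vector_space_axioms by (simp add: vector_space_on_def)
  have ext: "extending_datum scale A mA scale V \<Omega>"
    unfolding \<Omega>_def using extending_datum_component_datum[OF assms(1,2) AE c] .
  have lin: "linear_on P.scale (A \<times> V) scale E \<phi>"
    unfolding \<phi>_def using linear_on_add_complement[OF vs c] .
  have bij: "bij_betw \<phi> (A \<times> V) E"
    unfolding \<phi>_def using bij_betw_add_complement[OF vA c] .
  have mult: "\<phi> (unified_mult mA \<Omega> x y) = mE (\<phi> x) (\<phi> y)"
    if "x \<in> A \<times> V" "y \<in> A \<times> V" for x y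
    using that component_datum_mult[OF assms(2,3) complement_in_subset[OF c]]
    by (auto simp: \<phi>_def \<Omega>_def)
  have perm: "perm_algebra P.scale (A \<times> V) (unified_mult mA \<Omega>)"
  proof (rule perm_algebra_pullback[where f = \<phi>])
    show "inj_on \<phi> (A \<times> V)" using bij by (rule bij_betw_imp_inj_on)
  qed (fact assms(2) vAV lin mult unified_mult_closed[OF ext])+
  have "perm_extending_structure scale A mA scale V \<Omega>"
    using ext perm by (simp add: perm_extending_structure_def)
  moreover have "perm_algebra_iso P.scale (A \<times> V) (unified_mult mA \<Omega>) scale E mE \<phi>"
    using perm assms(2) lin bij mult by (simp add: perm_algebra_iso_def)
  moreover have "stabilizes A \<phi>" by (simp add: stabilizes_def \<phi>_def)
  moreover have "co_stabilizes A V \<phi>"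
    using proj_along_add[OF vA c] by (simp add: co_stabilizes_def \<phi>_def)
  ultimately show ?thesis using c by blast
qed

end
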